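(* Let $k\ge 1$. The number of unordered positions $\{a,b,a+b\}$, where $\{a,b\}$ is an unordered pair of positive integers with $a\oplus b\oplus(a+b)=0$, in which all three piles have at most $k$ binary digits, equals $\frac{3^k}{2}-2^k+\frac12$.
   Context: $\oplus$ denotes bitwise exclusive-or. *)

theory Defs
  imports "HOL-Library.Multiset" "HOL-Library.Log_Nat"
begin

unbundle bit_operations_syntax

text \<open>
  A position is the multiset of its three pile sizes. The number of binary digits of a
  pile \<^term>\<open>p\<close> is \<^term>\<open>floorlog 2 p\<close>.
\<close>

definition sum_positions :: "nat \<Rightarrow> nat multiset set" where
  "sum_positions k =
     {{#a, b, a + b#} | a b.
        a > 0 \<and> b > 0 \<and> a XOR b XOR (a + b) = 0 \<and>
        (\<forall>p \<in># {#a, b, a + b#}. floorlog 2 p \<le> k)}"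

end

theory Submission
  imports Defs
begin

text \<open>
  Since a + b = (a XOR b) + 2 (a AND b), the condition says that a and b have disjoint binary
  supports. Choosing for each of the k digits whether it belongs to a, to b or to neither gives
  3^k ordered pairs, of which 2 * 2^k - 1 have a zero entry. The remaining pairs have
  distinct entries, so each position arises from exactly two of them.
\<close>

text \<open>Since \<open>a\<close> and \<open>b\<close> are at most \<open>a + b\<close>, bounding
  the sum alone encodes the digit bound for all three piles.\<close>

definition disjoint_pairs :: "nat \<Rightarrow> (nat \<times> nat) set" where
  "disjoint_pairs k = {(a, b). a AND b = 0 \<and> a + b < 2 ^ k}"

text \<open>Binary addition: XOR is the carry-free sum, AND marks the positions that produce a
  carry. The induction strips the last digit of both numbers.\<close>

lemma xor_plus_twice_and_nat:
  fixes a b :: nat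
  shows "(a XOR b) + 2 * (a AND b) = a + b"
proof (induction a arbitrary: b rule: less_induct)
  case (less a)
  show ?case
  proof (cases "a = 0")
    case False
    then have IH: "(a div 2 XOR b div 2) + 2 * (a div 2 AND b div 2) = a div 2 + b div 2"
      by (intro less) simp
    have "a XOR b = (if even a = even b then 0 else 1) + 2 * (a div 2 XOR b div 2)"
      by (subst xor_rec) (auto simp: of_bool_def)
    moreover have "a AND b = (if odd a \<and> odd b then 1 else 0) + 2 * (a div 2 AND b div 2)"
      by (subst and_rec) (auto simp: of_bool_def)
    ultimately show ?thesis
      using IH by (cases "even a"; cases "even b"; clarsimp elim!: evenE oddE)
  qed simp
qed

lemma xor_xor_sum_eq_0_iff:
  fixes a b :: nat
  shows "a XOR b XOR (a + b) = 0 \<longleftrightarrow> a AND b = 0"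
proof -
  \<comment> \<open>XOR with a fixed number is its own inverse.\<close>
  have "a XOR b XOR (a + b) = 0 \<longleftrightarrow> a XOR b = a + b"
    by (metis xor.assoc xor.left_neutral xor.right_neutral xor_self_eq)
  then show ?thesis
    using xor_plus_twice_and_nat[of a b] by linarith
qed

text \<open>Splits off the lowest digits; disjointness rules out the fourth case, both odd. The
  bound survives a digit 1 because \<open>a + b < 2 ^ k\<close> gives
  \<open>2 * (a + b) + 1 < 2 ^ Suc k\<close>.\<close>

lemma disjoint_pairs_Suc:
  "disjoint_pairs (Suc k) =
     (\<lambda>(a, b). (2 * a, 2 * b)) ` disjoint_pairs k \<union>
     (\<lambda>(a, b). (2 * a + 1, 2 * b)) ` disjoint_pairs k \<union>
     (\<lambda>(a, b). (2 * a, 2 * b + 1)) ` disjoint_pairs k" (is "_ = ?R")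
proof (intro set_eqI iffI)
  fix x assume "x \<in> disjoint_pairs (Suc k)"
  then obtain a b where x: "x = (a, b)" "a AND b = 0" "a + b < 2 * 2 ^ k"
    by (auto simp: disjoint_pairs_def)
  have "of_bool (odd a \<and> odd b) + 2 * (a div 2 AND b div 2) = 0"
    using x(2) by (simp only: and_rec[symmetric])
  then have par: "even a \<or> even b" and "a div 2 AND b div 2 = 0"
    by auto
  moreover have "a div 2 + b div 2 < 2 ^ k"
    using x(3) by linarith
  ultimately have "(a div 2, b div 2) \<in> disjoint_pairs k"
    by (simp add: disjoint_pairs_def)
  then show "x \<in> ?R"
    using par unfolding x(1)
    by (cases "even a"; cases "even b") (force simp: image_iff elim!: evenE oddE)+
next
  fix x assume "x \<in> ?R"
  then show "x \<in> disjoint_pairs (Suc k)"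
    by (auto simp: disjoint_pairs_def and_rec[of "2 * _"] and_rec[of "Suc (2 * _)"])
qed

lemma finite_disjoint_pairs: "finite (disjoint_pairs k)"
  by (rule finite_subset[of _ "{..<2 ^ k} \<times> {..<2 ^ k}"]) (auto simp: disjoint_pairs_def)

lemma card_disjoint_pairs: "card (disjoint_pairs k) = 3 ^ k"
proof (induction k)
  case 0
  have "disjoint_pairs 0 = {(0, 0)}"
    by (auto simp: disjoint_pairs_def)
  then show ?case by simp
next
  case (Suc k)
  \<comment> \<open>Parity makes the three injective images pairwise disjoint, so the cardinality
    triples.\<close>
  have ne: "2 * m \<noteq> 2 * n + 1" "2 * m + 1 \<noteq> 2 * n" for m n :: nat
    by presburger+
  show ?case
    unfolding disjoint_pairs_Suc
    by (subst card_Un_disjoint; (subst card_Un_disjoint)?; (subst card_image)?; (subst card_image)?;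
        (subst card_image)?)
       (auto simp: finite_disjoint_pairs inj_on_def Suc ne[simplified])
qed

lemma card_positive_disjoint_pairs:
  "card {(a, b) \<in> disjoint_pairs k. a > 0 \<and> b > 0} + 2 * 2 ^ k = 3 ^ k + 1"
proof -
  let ?Q = "{(a, b) \<in> disjoint_pairs k. a > 0 \<and> b > 0}"
  \<comment> \<open>The pair \<open>(0, 0)\<close> is put into \<open>?A\<close> only, which keeps
    the two sets disjoint and accounts for the \<open>- 1\<close> below.\<close>
  let ?A = "{0::nat} \<times> {..<2 ^ k :: nat}" and ?B = "{0<..<2 ^ k :: nat} \<times> {0::nat}"
  have "disjoint_pairs k = ?Q \<union> (?A \<union> ?B)"
    by (auto simp: disjoint_pairs_def)
  then have "3 ^ k = card (?Q \<union> (?A \<union> ?B))"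
    by (simp add: card_disjoint_pairs)
  also have "\<dots> = card ?Q + card (?A \<union> ?B)"
    by (rule card_Un_disjoint) (auto intro: finite_subset[OF _ finite_disjoint_pairs])
  also have "card (?A \<union> ?B) = card ?A + card ?B"
    by (rule card_Un_disjoint) auto
  also have "card ?A + card ?B = 2 ^ k + (2 ^ k - 1)"
    by (simp add: card_cartesian_product)
  finally show ?thesis
    by (simp add: Suc_leI)
qed

text \<open>Swapping is a bijection between the halves \<open>a < b\<close> and
  \<open>b < a\<close>. The diagonal contributes nothing, as \<open>a AND a = a\<close> is nonzero
  for positive \<open>a\<close>.\<close>

lemma card_positive_eq_twice_ordered:
  "card {(a, b) \<in> disjoint_pairs k. a > 0 \<and> b > 0} =
     2 * card {(a, b) \<in> disjoint_pairs k. 0 < a \<and> a < b}"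
proof -
  let ?L = "{(a, b) \<in> disjoint_pairs k. 0 < a \<and> a < b}"
  have fin: "finite ?L"
    by (auto intro: finite_subset[OF _ finite_disjoint_pairs])
  have "{(a, b) \<in> disjoint_pairs k. a > 0 \<and> b > 0} = ?L \<union> prod.swap ` ?L"
    by (auto simp: disjoint_pairs_def image_iff and.commute add.commute neq_iff)
       (metis and.idem nat_neq_iff not_gr_zero)+
  moreover have "card (?L \<union> prod.swap ` ?L) = card ?L + card (prod.swap ` ?L)"
    using fin by (intro card_Un_disjoint) auto
  ultimately show ?thesis
    by (simp add: card_image)
qed

lemma sum_positions_eq_image:
  "sum_positions k = (\<lambda>(a, b). {#a, b, a + b#}) ` {(a, b) \<in> disjoint_pairs k. 0 < a \<and> a < b}"
proof -
  have "sum_positions k =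
      {{#a, b, a + b#} | a b. a > 0 \<and> b > 0 \<and> (a, b) \<in> disjoint_pairs k}"
    unfolding sum_positions_def xor_xor_sum_eq_0_iff
    by (intro Collect_cong ex_cong1) (auto simp: disjoint_pairs_def floorlog_le_iff)
  also have "\<dots> = (\<lambda>(a, b). {#a, b, a + b#}) ` {(a, b) \<in> disjoint_pairs k. 0 < a \<and> a < b}"
    (is "_ = ?R")
  proof (intro equalityI subsetI)
    fix M assume "M \<in> {{#a, b, a + b#} | a b. a > 0 \<and> b > 0 \<and> (a, b) \<in> disjoint_pairs k}"
    then obtain a b where M: "M = {#a, b, a + b#}" "a > 0" "b > 0" "(a, b) \<in> disjoint_pairs k"
      by blast
    then have "a \<noteq> b"
      by (auto simp: disjoint_pairs_def)
    then consider "a < b" | "b < a"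
      by linarith
    then show "M \<in> ?R"
    proof cases
      case 1
      then show ?thesis using M by force
    next
      case 2
      have "(b, a) \<in> disjoint_pairs k" "M = {#b, a, b + a#}"
        using M by (auto simp: disjoint_pairs_def and.commute add.commute)
      then show ?thesis using 2 M(3) by force
    qed
  qed force
  finally show ?thesis .
qed

text \<open>The entries add up to \<open>2 * (a + b)\<close>, so the multiset determines its pile
  \<open>a + b\<close>. Removing that pile leaves \<open>a\<close> and \<open>b\<close>, and
  \<open>a < b\<close> tells them apart.\<close>

lemma inj_on_position:
  "inj_on (\<lambda>(a, b). {#a, b, a + b#}) {(a, b :: nat). a < b}"
proof (rule inj_onI, clarsimp)
  fix a b c d :: nat
  assume lt: "a < b" "c < d" and eq: "{#a, b, a + b#} = {#c, d, c + d#}"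
  have "a + b = c + d"
    using arg_cong[OF eq, of sum_mset] by simp
  moreover from this eq have "{#a, b#} = {#c, d#}"
    by (simp add: add_mset_commute)
  ultimately show "a = c \<and> b = d"
    using lt by (auto simp: add_eq_conv_diff)
qed

theorem theorem7p9:
  fixes k :: nat
  assumes "k \<ge> 1"
  shows "finite (sum_positions k) \<and>
    real (card (sum_positions k)) = 3 ^ k / 2 - 2 ^ k + 1 / 2"
proof
  let ?L = "{(a, b) \<in> disjoint_pairs k. 0 < a \<and> a < b}"
  have "finite ?L"
    by (auto intro: finite_subset[OF _ finite_disjoint_pairs])
  then show "finite (sum_positions k)"
    by (simp add: sum_positions_eq_image)
  have "card (sum_positions k) = card ?L"
    unfolding sum_positions_eq_image
    by (rule card_image) (auto intro: inj_on_subset[OF inj_on_position])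
  \<comment> \<open>Kept additive over the naturals, so that subtraction and halving occur only
    after the passage to the reals.\<close>
  then have "2 * card (sum_positions k) + 2 * 2 ^ k = 3 ^ k + 1"
    using card_positive_disjoint_pairs[of k] card_positive_eq_twice_ordered[of k] by simp
  then have "real (2 * card (sum_positions k) + 2 * 2 ^ k) = real (3 ^ k + 1)"
    by (rule arg_cong)
  then show "real (card (sum_positions k)) = 3 ^ k / 2 - 2 ^ k + 1 / 2"
    by simp
qed

end
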